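(* Let $G(r,c)$, $r,c\in\mathbb N$, be the table of Sprague-Grundy values of the single-quadrant queen game on $\mathbb N\times\mathbb N$ numbered along upward antidiagonals. Then every column and every row of the table is a permutation of $\mathbb N$; that is, for each $c\ge0$ the map $r\mapsto G(r,c)$ is a bijection $\mathbb N\to\mathbb N$, and for each $r\ge0$ the map $c\mapsto G(r,c)$ is a bijection $\mathbb N\to\mathbb N$.
   Context: $\mathbb N=\{0,1,2,\ldots\}$. The cell in row $r$ and column $c$ (rows numbered downward, columns numbered rightward, both from $0$) of the board $\mathbb N\times\mathbb N$ is $(r,c)$. The cells are numbered $0,1,2,\ldots$ along successive upward antidiagonals: $(0,0),(1,0),(0,1),(2,0),(1,1),(0,2),(3,0),\ldots$, so cell $(r,c)$ has number $\frac{(r+c)(r+c+1)}2+c$. In the game, a queen is placed on a cell and two players alternately move it to a lower-numbered cell that is a queen's move away (same row, same column, or same diagonal or antidiagonal, any distance); the first player unable to move loses. The Sprague-Grundy value $G(r,c)$ is the mex (smallest nonnegative integer not in the set) of the values $G(r',c')$ over all cells $(r',c')$ to which there is a legal move from $(r,c)$. *)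

theory Defs
  imports Main
begin

text \<open>A cell is a pair \<open>(r, c)\<close>: row \<open>r\<close>, counted downward, and column \<open>c\<close>, counted rightward.\<close>
type_synonym cell = "nat \<times> nat"

definition cell_number :: "cell \<Rightarrow> nat" where
  "cell_number = (\<lambda>(r, c). (r + c) * (r + c + 1) div 2 + c)"

text \<open>The four disjuncts: same row, same column, same diagonal, same antidiagonal.  The diagonal
  condition is \<open>r - c = r' - c'\<close>, rearranged to avoid truncated subtraction.\<close>
definition queen_aligned :: "cell \<Rightarrow> cell \<Rightarrow> bool" where
  "queen_aligned = (\<lambda>(r, c) (r', c'). r = r' \<or> c = c' \<or> r + c' = r' + c \<or> r + c = r' + c')"

definition moves :: "cell \<Rightarrow> cell set" where
  "moves p = {q. queen_aligned p q \<and> cell_number q < cell_number p}"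

definition mex :: "nat set \<Rightarrow> nat" where
  "mex A = (LEAST n. n \<notin> A)"

function sg_value :: "cell \<Rightarrow> nat" where
  "sg_value p = mex (sg_value ` moves p)"
  by auto
termination
  by (relation "measure cell_number") (auto simp: moves_def)

declare sg_value.simps [simp del]

definition G :: "nat \<Rightarrow> nat \<Rightarrow> nat" where
  "G r c = sg_value (r, c)"

end

theory Submission
  imports Defs
begin

text \<open>
  Two distinct aligned cells carry different values, because the higher-numbered one has a move to
  the other; so a value \<open>v\<close> occurs at most once in each row, column, diagonal and antidiagonal.  This
  gives injectivity, and leaves the claim that every \<open>v\<close> occurs in every row and column.

  Suppose that \<open>v\<close> is missing from some row or column.  Only finitely many cells of that line have a
  value less than \<open>v\<close>; from every other one there is a move to a cell of value \<open>v\<close>.  Any finite set of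
  cells off the line is aligned with only finitely many cells of the line, so far out on the line
  the cell of value \<open>v\<close> must lie outside any prescribed finite set (\<open>missing_value_reachable\<close>).

  For column \<open>c\<close> this is absurd: all cells reachable from column \<open>c\<close> outside that column lie in the
  columns to its left, which contain \<open>v\<close> at most \<open>c\<close> times.  For row \<open>r\<close>, the rows above contain \<open>v\<close>
  at most \<open>r\<close> times, and the only moves to a row below run along the antidiagonal.  Hence every
  antidiagonal from some point on contains \<open>v\<close>.  This density is impossible
  (\<open>antidiagonal_without_value\<close>): choose one occurrence of \<open>v\<close> on each of \<open>m\<close> consecutive antidiagonals
  and add up \<open>row + column\<close>.  The total is \<open>m\<^sup>2 / 2 + O(m)\<close>, being a sum of consecutive antidiagonal
  indices, but at least \<open>m (m - 1)\<close>, since the \<open>m\<close> rows are distinct and so are the \<open>m\<close> columns.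
\<close>

lemma cell_number_less_iff:
  "cell_number (r', c') < cell_number (r, c) \<longleftrightarrow>
    r' + c' < r + c \<or> r' + c' = r + c \<and> c' < c"
proof -
  have step: "s * (s + 1) div 2 + s < t * (t + 1) div 2" if "s < t" for s t :: nat
  proof -
    have "Suc s * (Suc s + 1) \<le> t * (t + 1)"
      using that by (intro mult_le_mono) auto
    then have "Suc s * (Suc s + 1) div 2 \<le> t * (t + 1) div 2"
      by (rule div_le_mono)
    moreover have "Suc s * (Suc s + 1) = s * (s + 1) + 2 * Suc s"
      by simp
    ultimately show ?thesis
      by simp
  qed
  show ?thesis
    using step[of "r' + c'" "r + c"] step[of "r + c" "r' + c'"]
    by (cases "r' + c'" "r + c" rule: linorder_cases) (auto simp: cell_number_def)
qed

lemma moves_iff: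
  "(r', c') \<in> moves (r, c) \<longleftrightarrow>
    queen_aligned (r, c) (r', c') \<and> (r' + c' < r + c \<or> r' + c' = r + c \<and> c' < c)"
  unfolding moves_def mem_Collect_eq cell_number_less_iff ..

lemma moves_total:
  assumes "queen_aligned p q" "p \<noteq> q"
  shows "q \<in> moves p \<or> p \<in> moves q"
  using assms by (cases p; cases q) (auto simp: moves_iff queen_aligned_def)

lemma finite_moves: "finite (moves p)"
proof -
  obtain r c where p: "p = (r, c)"
    by (cases p)
  have "moves p \<subseteq> {..r + c} \<times> {..r + c}"
    unfolding p by (auto simp: moves_iff)
  then show ?thesis
    by (rule finite_subset) simp
qed

lemma sg_value_moves_neq:
  assumes "q \<in> moves p"
  shows "sg_value q \<noteq> sg_value p"
proof -
  have "\<exists>n. n \<notin> sg_value ` moves p"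
    using finite_moves[of p] by (intro ex_new_if_finite) auto
  then have "sg_value p \<notin> sg_value ` moves p"
    unfolding sg_value.simps[of p] mex_def by (rule LeastI_ex)
  then show ?thesis
    using assms by (metis imageI)
qed

lemma sg_value_aligned_eqD:
  assumes "queen_aligned p q" "sg_value p = sg_value q"
  shows "p = q"
  using assms moves_total sg_value_moves_neq by metis

lemma sg_value_reaches_smaller:
  assumes "v < sg_value p"
  shows "\<exists>q\<in>moves p. sg_value q = v"
proof -
  have "v \<in> sg_value ` moves p"
    using assms not_less_Least unfolding sg_value.simps[of p] mex_def by blast
  then show ?thesis
    by blast
qed

lemma inj_row: "inj (\<lambda>c. sg_value (r, c))"
  by (rule injI, drule sg_value_aligned_eqD[rotated]) (auto simp: queen_aligned_def)

lemma inj_column: "inj (\<lambda>r. sg_value (r, c))"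
  by (rule injI, drule sg_value_aligned_eqD[rotated]) (auto simp: queen_aligned_def)

text \<open>The sequence \<open>f\<close> stands for a row or a column, so that both can be treated at once.\<close>
lemma missing_value_reachable:
  fixes f :: "nat \<Rightarrow> cell"
  assumes inj: "inj (\<lambda>i. sg_value (f i))"
    and missing: "\<And>i. sg_value (f i) \<noteq> v"
    and "finite A"
    and aligned: "\<And>q. q \<in> A \<Longrightarrow> finite {i. queen_aligned (f i) q}"
  shows "\<exists>M. \<forall>i\<ge>M. \<exists>q\<in>moves (f i). q \<notin> A \<and> sg_value q = v"
proof -
  let ?B = "(\<lambda>i. sg_value (f i)) -` {..<v} \<union> (\<Union>q\<in>A. {i. queen_aligned (f i) q})"
  have "finite ?B"
    using \<open>finite A\<close> aligned inj by (auto intro: finite_vimageI)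
  then obtain M where M: "\<forall>i\<in>?B. i < M"
    using finite_nat_set_iff_bounded by blast
  have "\<exists>q\<in>moves (f i). q \<notin> A \<and> sg_value q = v" if "i \<ge> M" for i
  proof -
    have i: "i \<notin> ?B"
      using M that by (metis not_less)
    then have "v < sg_value (f i)"
      using missing[of i] by auto
    then obtain q where "q \<in> moves (f i)" "sg_value q = v"
      using sg_value_reaches_smaller by blast
    moreover from this have "q \<notin> A"
      using i by (auto simp: moves_def)
    ultimately show ?thesis
      by blast
  qed
  then show ?thesis
    by blast
qed

lemma surj_column: "surj (\<lambda>r. sg_value (r, c))"
proof (rule ccontr)
  assume "\<not> surj (\<lambda>r. sg_value (r, c))"
  then obtain v where v: "\<And>r. sg_value (r, c) \<noteq> v"
    unfolding surj_def by metis
  let ?A = "{q. snd q < c \<and> sg_value q = v}"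
  have "inj_on snd ?A"
    by (rule inj_onI, rule sg_value_aligned_eqD) (auto simp: queen_aligned_def)
  moreover have "finite (snd ` ?A)"
    by (rule finite_subset[of _ "{..<c}"]) auto
  ultimately have fin: "finite ?A"
    by (rule finite_imageD[rotated])
  have "finite {r. queen_aligned (r, c) q}" if "q \<in> ?A" for q
    by (rule finite_subset[of _ "{..fst q + snd q + c}"])
      (use that in \<open>auto simp: queen_aligned_def\<close>)
  from missing_value_reachable[OF inj_column v fin this]
  obtain M where "\<exists>q\<in>moves (M, c). q \<notin> ?A \<and> sg_value q = v"
    by blast
  then obtain r' c' where q: "(r', c') \<in> moves (M, c)" "\<not> c' < c" "sg_value (r', c') = v"
    by auto
  then have "c' = c"
    by (auto simp: moves_iff queen_aligned_def)
  then show False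
    using q v by auto
qed

text \<open>A set of \<open>m\<close> natural numbers has sum at least \<open>0 + 1 + \<dots> + (m - 1)\<close>.\<close>
lemma card_square_le_sum:
  fixes S :: "nat set"
  assumes "finite S"
  shows "card S * card S \<le> 2 * \<Sum>S + card S"
  using assms
proof (induction S rule: finite_linorder_max_induct)
  case empty
  then show ?case by simp
next
  case (insert b A)
  have "card A \<le> card {..<b}"
    using insert.hyps by (intro card_mono) auto
  moreover have "b \<notin> A"
    using insert.hyps by auto
  ultimately show ?case
    using insert by simp
qed

lemma antidiagonal_without_value:
  "\<exists>n\<ge>N. \<forall>r c. r + c = n \<longrightarrow> sg_value (r, c) \<noteq> v"
proof (rule ccontr)
  assume "\<not> ?thesis"
  then have "\<forall>n\<ge>N. \<exists>q. fst q + snd q = n \<and> sg_value q = v"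
    by (metis fst_conv snd_conv)
  then obtain q where q: "\<And>n. n \<ge> N \<Longrightarrow> fst (q n) + snd (q n) = n \<and> sg_value (q n) = v"
    by metis
  \<comment> \<open>The smallest number \<open>m\<close> of antidiagonals with \<open>m (m - 1) > m N + m (m - 1) / 2\<close>.\<close>
  define m where "m = 2 * N + 2"
  let ?I = "{N..<N + m}"
  have "k = n" if "k \<in> ?I" "n \<in> ?I" "fst (q k) = fst (q n) \<or> snd (q k) = snd (q n)" for k n
  proof -
    have "queen_aligned (q k) (q n)"
      using that(3) by (auto simp: queen_aligned_def split: prod.split)
    then have "q k = q n"
      using q[of k] q[of n] that(1,2) by (intro sg_value_aligned_eqD) auto
    then show ?thesis
      using q that(1,2) by (metis atLeastLessThan_iff)
  qed
  then have "inj_on (\<lambda>n. fst (q n)) ?I" "inj_on (\<lambda>n. snd (q n)) ?I"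
    by (simp_all add: inj_on_def)
  then have card: "card ((\<lambda>n. fst (q n)) ` ?I) = m" "card ((\<lambda>n. snd (q n)) ` ?I) = m"
    and sum: "\<Sum>((\<lambda>n. fst (q n)) ` ?I) = (\<Sum>n\<in>?I. fst (q n))"
      "\<Sum>((\<lambda>n. snd (q n)) ` ?I) = (\<Sum>n\<in>?I. snd (q n))"
    by (simp_all add: card_image sum.reindex)
  have "m * m \<le> 2 * (\<Sum>n\<in>?I. fst (q n)) + m" "m * m \<le> 2 * (\<Sum>n\<in>?I. snd (q n)) + m"
    using card_square_le_sum[of "(\<lambda>n. fst (q n)) ` ?I"] card_square_le_sum[of "(\<lambda>n. snd (q n)) ` ?I"]
    unfolding card sum by auto
  moreover have "(\<Sum>n\<in>?I. fst (q n)) + (\<Sum>n\<in>?I. snd (q n)) = \<Sum>?I"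
    unfolding sum.distrib[symmetric] by (rule sum.cong) (use q in auto)
  moreover have "2 * \<Sum>{N..<N + k} + k = 2 * k * N + k * k" for k
    by (induction k) (simp_all add: algebra_simps)
  from this[of m] have "2 * \<Sum>?I + m = 2 * m * N + m * m" .
  ultimately have "m * m \<le> 2 * m * N + m"
    by linarith
  then have "m * m \<le> m * (2 * N + 1)"
    by (simp add: algebra_simps)
  then show False
    by (simp add: m_def)
qed

lemma surj_row: "surj (\<lambda>c. sg_value (r, c))"
proof (rule ccontr)
  assume "\<not> surj (\<lambda>c. sg_value (r, c))"
  then obtain v where v: "\<And>c. sg_value (r, c) \<noteq> v"
    unfolding surj_def by metis
  let ?A = "{q. fst q < r \<and> sg_value q = v}"
  have "inj_on fst ?A"
    by (rule inj_onI, rule sg_value_aligned_eqD) (auto simp: queen_aligned_def)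
  moreover have "finite (fst ` ?A)"
    by (rule finite_subset[of _ "{..<r}"]) auto
  ultimately have fin: "finite ?A"
    by (rule finite_imageD[rotated])
  have "finite {c. queen_aligned (r, c) q}" if "q \<in> ?A" for q
    by (rule finite_subset[of _ "{..fst q + snd q + r}"])
      (use that in \<open>auto simp: queen_aligned_def\<close>)
  from missing_value_reachable[OF inj_row v fin this]
  obtain M where M: "\<And>c. c \<ge> M \<Longrightarrow> \<exists>q\<in>moves (r, c). q \<notin> ?A \<and> sg_value q = v"
    by blast
  obtain n where n: "n \<ge> r + M" "\<And>r' c'. r' + c' = n \<Longrightarrow> sg_value (r', c') \<noteq> v"
    using antidiagonal_without_value by blast
  then have "M \<le> n - r"
    by simp
  from M[OF this] obtain r' c' where q: "(r', c') \<in> moves (r, n - r)" "\<not> r' < r" "sg_value (r', c') = v"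
    by auto
  have "r' \<noteq> r"
    using q v by auto
  then have "r' + c' = r + (n - r)"
    using q by (auto simp: moves_iff queen_aligned_def)
  then show False
    using q n by auto
qed

theorem theorem23:
  shows "(\<forall>c. bij (\<lambda>r. G r c)) \<and> (\<forall>r. bij (\<lambda>c. G r c))"
  unfolding G_def bij_def using inj_row inj_column surj_row surj_column by blast

end
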